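(* For each finite graph $X$ and any $p\in X$, there exist a continuum $Y$ which is not a finite graph, and a point $y\in Y$, such that $C(p,X)$ is homeomorphic to $C(y,Y)$.
   Context: A continuum is a nonempty compact connected metric space. For a continuum $X$ and $p\in X$, $C(p,X)$ is the set of all closed connected nonempty subsets $A\subset X$ with $p\in A$, endowed with the Hausdorff metric. An arc is a space homeomorphic to $[0,1]$. A finite graph is a continuum which can be written as the union of finitely many arcs, any two of which are either disjoint or intersect only in one or both of their end points. *)

theory Defs
  imports "HOL-Analysis.Analysis"
begin

text \<open>A metric space is represented by a subset of a type of class \<^class>\<open>metric_space\<close>,
  carrying the restricted metric. Every compact metric space embeds topologically in
  \<open>nat \<Rightarrow> real\<close> (Hilbert cube), so, up to homeomorphism, the subsets of that type include all
  continua.\<close>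

definition continuum :: "'a::metric_space set \<Rightarrow> bool" where
  "continuum X \<longleftrightarrow> X \<noteq> {} \<and> compact X \<and> connected X"

definition is_arc :: "'a::metric_space set \<Rightarrow> bool" where
  "is_arc A \<longleftrightarrow> A homeomorphic {0..1::real}"

text \<open>Every homeomorphism from \<open>{0..1}\<close> onto \<open>A\<close> yields the same two end points, so
  quantifying over all of them is harmless.\<close>

definition arc_ends :: "'a::metric_space set \<Rightarrow> 'a set" where
  "arc_ends A = {x. \<exists>h k. homeomorphism {0..1::real} A h k \<and> (x = h 0 \<or> x = h 1)}"

text \<open>The inclusion covers the disjoint case. A common point of two of the arcs has to be an end
  point of both of them.\<close>

definition finite_graph :: "'a::metric_space set \<Rightarrow> bool" where
  "finite_graph X \<longleftrightarrow> continuum X \<and>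
     (\<exists>\<A>. finite \<A> \<and> (\<forall>A\<in>\<A>. is_arc A) \<and> X = \<Union>\<A> \<and>
        (\<forall>A\<in>\<A>. \<forall>B\<in>\<A>. A \<noteq> B \<longrightarrow> A \<inter> B \<subseteq> arc_ends A \<inter> arc_ends B))"

definition C_set :: "'a::metric_space \<Rightarrow> 'a set \<Rightarrow> 'a set set" where
  "C_set p X = {A. closedin (top_of_set X) A \<and> connected A \<and> p \<in> A}"

text \<open>The value \<open>0\<close> outside the nonempty bounded sets only makes the function total;
  \<^locale>\<open>Metric_space\<close> requires nonnegativity on the whole type.\<close>

definition hausdorff_dist :: "'a::metric_space set \<Rightarrow> 'a set \<Rightarrow> real" where
  "hausdorff_dist A B =
     (if A \<noteq> {} \<and> B \<noteq> {} \<and> bounded A \<and> bounded B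
      then max (SUP a\<in>A. infdist a B) (SUP b\<in>B. infdist b A) else 0)"

definition C_space :: "'a::metric_space \<Rightarrow> 'a set \<Rightarrow> 'a set topology" where
  "C_space p X = Metric_space.mtopology (C_set p X) hausdorff_dist"

lemma bdd_above_infdist:
  assumes "bounded A" "B \<noteq> {}"
  shows "bdd_above ((\<lambda>a. infdist a B) ` A)"
proof -
  obtain b where b: "b \<in> B" using assms by blast
  obtain e where "\<forall>a\<in>A. dist b a \<le> e" using assms(1) bounded_any_center by blast
  then show ?thesis
    using b by (intro bdd_aboveI2[where M = e]) (metis dist_commute infdist_le2)
qed

lemma hausdorff_dist_le_iff:
  assumes "A \<noteq> {}" "B \<noteq> {}" "bounded A" "bounded B"
  shows "hausdorff_dist A B \<le> e \<longleftrightarrow> (\<forall>a\<in>A. infdist a B \<le> e) \<and> (\<forall>b\<in>B. infdist b A \<le> e)"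
  using assms by (simp add: hausdorff_dist_def cSUP_le_iff bdd_above_infdist)

lemma Metric_space_C_set:
  assumes "compact X"
  shows "Metric_space (C_set p X) hausdorff_dist"
proof
  have C: "A \<noteq> {}" "bounded A" "closed A" if "A \<in> C_set p X" for A
    using that assms closedin_compact[of X A] compact_imp_bounded compact_imp_closed
    by (auto simp: C_set_def)
  have nn: "0 \<le> hausdorff_dist A B" for A B :: "'a set"
  proof (cases "A \<noteq> {} \<and> B \<noteq> {} \<and> bounded A \<and> bounded B")
    case True
    then obtain a where "a \<in> A" by blast
    then have "infdist a B \<le> hausdorff_dist A B"
      using True hausdorff_dist_le_iff[of A B "hausdorff_dist A B"] by blast
    then show ?thesis using infdist_nonneg[of a B] by linarith
  qed (auto simp: hausdorff_dist_def)
  show "0 \<le> hausdorff_dist A B" for A B :: "'a set" by (rule nn)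
  show "hausdorff_dist A B = hausdorff_dist B A" for A B :: "'a set"
    by (auto simp: hausdorff_dist_def max.commute)
  show "hausdorff_dist A B = 0 \<longleftrightarrow> A = B" if "A \<in> C_set p X" "B \<in> C_set p X" for A B
  proof -
    have "hausdorff_dist A B = 0 \<longleftrightarrow> hausdorff_dist A B \<le> 0"
      using nn[of A B] by linarith
    also have "\<dots> \<longleftrightarrow> (\<forall>a\<in>A. infdist a B = 0) \<and> (\<forall>b\<in>B. infdist b A = 0)"
      using that C by (simp add: hausdorff_dist_le_iff infdist_nonneg order_antisym_conv)
    also have "\<dots> \<longleftrightarrow> A = B"
      using that C in_closed_iff_infdist_zero by blast
    finally show ?thesis .
  qed
  show "hausdorff_dist A D \<le> hausdorff_dist A B + hausdorff_dist B D"
    if "A \<in> C_set p X" "B \<in> C_set p X" "D \<in> C_set p X" for A B D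
  proof -
    have *: "infdist a D \<le> hausdorff_dist A B + hausdorff_dist B D"
      if "A \<in> C_set p X" "B \<in> C_set p X" "D \<in> C_set p X" "a \<in> A" for A B D a
    proof -
      have "infdist a D - hausdorff_dist B D \<le> dist a b" if "b \<in> B" for b
      proof -
        have "infdist b D \<le> hausdorff_dist B D"
          using C[OF \<open>B \<in> C_set p X\<close>] C[OF \<open>D \<in> C_set p X\<close>] that
            hausdorff_dist_le_iff[of B D "hausdorff_dist B D"] by blast
        then show ?thesis using infdist_triangle[of a D b] by linarith
      qed
      then have "infdist a D - hausdorff_dist B D \<le> infdist a B"
        using C[OF \<open>B \<in> C_set p X\<close>] by (simp add: infdist_notempty cINF_greatest)
      moreover have "infdist a B \<le> hausdorff_dist A B"
        using C[OF \<open>A \<in> C_set p X\<close>] C[OF \<open>B \<in> C_set p X\<close>] \<open>a \<in> A\<close>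
          hausdorff_dist_le_iff[of A B "hausdorff_dist A B"] by blast
      ultimately show ?thesis by linarith
    qed
    have comm: "hausdorff_dist A B = hausdorff_dist B A" for A B :: "'a set"
      by (auto simp: hausdorff_dist_def max.commute)
    show ?thesis
      using that C *[of A B D] *[of D B A] comm
      by (auto simp: hausdorff_dist_le_iff add.commute)
  qed
qed

end

theory Submission
  imports Defs
begin

text \<open>Choose \<open>q \<in> X\<close> different from \<open>p\<close>, and let \<open>Y\<close> be the graph over \<open>X - {q}\<close> of
  \<open>x \<mapsto> sin (1 / dist x q)\<close> together with the limit bar \<open>{q} \<times> [-1, 1]\<close>. A subcontinuum of \<open>Y\<close>
  that contains the point over \<open>p\<close> and meets the bar projects onto a connected set containing
  \<open>p\<close> and \<open>q\<close>, on which \<open>dist x q\<close> takes all small values; being closed, it contains the whole bar.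
  So taking preimages under the projection \<open>Y \<rightarrow> X\<close> is a bijection between the two hyperspaces,
  and a homeomorphism. But \<open>Y\<close> is not locally connected at the bar, whereas a finite union of arcs
  is locally connected.\<close>

subsection \<open>Hyperspaces and monotone maps\<close>

lemma C_set_compact:
  assumes "compact X" "A \<in> C_set p X"
  shows "A \<subseteq> X" "compact A" "closed A" "bounded A" "connected A" "p \<in> A" "A \<noteq> {}"
proof -
  show "A \<subseteq> X" "connected A" "p \<in> A" "A \<noteq> {}"
    using assms by (auto simp: C_set_def closedin_def)
  show "compact A" using assms closedin_compact by (auto simp: C_set_def)
  then show "closed A" "bounded A" by (auto simp: compact_imp_closed compact_imp_bounded)
qed

lemma C_setI:
  "\<lbrakk>closed A; A \<subseteq> X; connected A; p \<in> A\<rbrakk> \<Longrightarrow> A \<in> C_set p X"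
  by (auto simp: C_set_def closed_subset)

lemma infdist_le_hausdorff_dist:
  assumes "compact X" "A \<in> C_set p X" "B \<in> C_set p X" "a \<in> A"
  shows "infdist a B \<le> hausdorff_dist A B"
  using hausdorff_dist_le_iff[of A B "hausdorff_dist A B"]
    C_set_compact[OF assms(1,2)] C_set_compact[OF assms(1,3)] assms(4) by auto

lemma infdist_less_obtain:
  assumes "infdist x A < e" "A \<noteq> {}"
  obtains a where "a \<in> A" "dist x a < e"
  using assms by (auto simp: infdist_notempty cINF_less_iff)

text \<open>The points of \<open>Y\<close> at distance at least \<open>e\<close> from the preimage
  of \<open>B\<close> form a compact set \<open>K\<close>. On it the distance from
  \<open>f t\<close> to \<open>B\<close> attains a minimum, which is positive since \<open>K\<close>
  misses the preimage and \<open>B\<close> is closed. This is the upper semicontinuity of taking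
  preimages.\<close>

lemma infdist_preimage_small:
  fixes f :: "'b::metric_space \<Rightarrow> 'a::metric_space"
  assumes Y: "compact Y" and f: "continuous_on Y f" and B: "closed B" "B \<noteq> {}" and e: "0 < e"
  shows "\<exists>d>0. \<forall>t\<in>Y. infdist (f t) B < d \<longrightarrow> infdist t (Y \<inter> f -` B) < e"
proof -
  define K where "K = {t\<in>Y. e \<le> infdist t (Y \<inter> f -` B)}"
  have "K = Y \<inter> {t. e \<le> infdist t (Y \<inter> f -` B)}" by (auto simp: K_def)
  moreover have "closed {t. e \<le> infdist t (Y \<inter> f -` B)}"
    by (intro closed_Collect_le continuous_intros)
  ultimately have K: "compact K" using Y by (simp add: compact_Int_closed)
  show ?thesis
  proof (cases "K = {}")
    case True
    then show ?thesis by (intro exI[of _ 1]) (auto simp: K_def)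
  next
    case False
    have "continuous_on K (\<lambda>t. infdist (f t) B)"
      using f by (intro continuous_intros) (auto simp: K_def intro: continuous_on_subset)
    then obtain k where k: "k \<in> K" "\<And>t. t \<in> K \<Longrightarrow> infdist (f k) B \<le> infdist (f t) B"
      using continuous_attains_inf[OF K False] by blast
    have "f k \<notin> B"
    proof
      assume "f k \<in> B"
      then have "infdist k (Y \<inter> f -` B) = 0" using k by (auto simp: K_def)
      then show False using k e by (auto simp: K_def)
    qed
    then have "infdist (f k) B > 0"
      using B in_closed_iff_infdist_zero infdist_nonneg[of "f k" B] by fastforce
    moreover have "infdist t (Y \<inter> f -` B) < e" if "t \<in> Y" "infdist (f t) B < infdist (f k) B" for t
      using k(2)[of t] that by (force simp: K_def)
    ultimately show ?thesis by blast
  qed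
qed

text \<open>Compactness of \<open>Y\<close> makes \<open>f\<close> a closed map, and a closed map
  with connected fibres pulls connected sets back to connected sets.\<close>

lemma connected_preimage_compact:
  fixes f :: "'b::metric_space \<Rightarrow> 'a::metric_space"
  assumes "compact Y" and f: "continuous_on Y f" "f ` Y = X"
    and "\<And>x. x \<in> X \<Longrightarrow> connected (Y \<inter> f -` {x})" and "connected C" "C \<subseteq> X"
  shows "connected (Y \<inter> f -` C)"
proof (rule connected_closed_monotone_preimage[OF f])
  fix K assume "closedin (top_of_set Y) K"
  then have "compact K" "K \<subseteq> Y"
    using assms(1) closedin_compact by (auto dest: closedin_imp_subset)
  then have "compact (f ` K)"
    using compact_continuous_image f(1) continuous_on_subset by blast
  then show "closedin (top_of_set X) (f ` K)"
    using \<open>K \<subseteq> Y\<close> f(2) by (auto intro!: closed_subset compact_imp_closed)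
qed (use assms in auto)

text \<open>The set \<open>S\<close> consists of points that are alone in their fibre. Its preimages being dense is
  what makes \<open>A \<mapsto> f ` A\<close> injective and its inverse lower semicontinuous.\<close>

lemma C_space_homeomorphic_monotone:
  fixes f :: "'b::metric_space \<Rightarrow> 'a::metric_space"
  assumes X: "compact X" and Y: "compact Y" and f: "continuous_on Y f" and im: "f ` Y = X"
    and y: "y \<in> Y" "f y = p"
    and mono: "\<And>x. x \<in> X \<Longrightarrow> connected (Y \<inter> f -` {x})"
    and S: "S \<subseteq> Y" "\<And>s t. s \<in> S \<Longrightarrow> t \<in> Y \<Longrightarrow> f t = f s \<Longrightarrow> t = s"
    and dense: "\<And>B. B \<in> C_set p X \<Longrightarrow> Y \<inter> f -` B \<subseteq> closure (S \<inter> f -` B)"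
  shows "C_space p X homeomorphic_space C_space y Y"
proof -
  note CX = C_set_compact[OF X, of _ p] and CY = C_set_compact[OF Y, of _ y]
  interpret MX: Metric_space "C_set p X" hausdorff_dist by (rule Metric_space_C_set[OF X])
  interpret MY: Metric_space "C_set y Y" hausdorff_dist by (rule Metric_space_C_set[OF Y])
  have pre: "Y \<inter> f -` B \<in> C_set y Y" if "B \<in> C_set p X" for B
  proof (rule C_setI)
    show "closed (Y \<inter> f -` B)"
      by (rule continuous_closed_preimage[OF f compact_imp_closed[OF Y] CX(3)[OF that]])
    show "connected (Y \<inter> f -` B)"
      using connected_preimage_compact[OF Y f im mono] CX(1,5)[OF that] by blast
  qed (use y CX(6)[OF that] in auto)
  have img: "f ` A \<in> C_set p X" if "A \<in> C_set y Y" for A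
  proof (rule C_setI)
    have fA: "continuous_on A f" using f CY(1)[OF that] continuous_on_subset by blast
    show "closed (f ` A)" using compact_continuous_image[OF fA CY(2)[OF that]] compact_imp_closed
      by blast
    show "connected (f ` A)" using connected_continuous_image[OF fA CY(5)[OF that]] .
  qed (use y im CY(1,6)[OF that] in auto)
  have img_pre: "f ` (Y \<inter> f -` B) = B" if "B \<in> C_set p X" for B
    using CX(1)[OF that] im by auto
  \<comment> \<open>A point of \<open>S\<close> over \<open>f\<close>
    A\<open>is alone in its fibre, hence lies in\<close>A\<open>; such points are dense in the preimage of\<close>f
    \<open>A\<close>, and \<open>A\<close> is closed.\<close>
  have pre_img: "Y \<inter> f -` (f ` A) = A" if A: "A \<in> C_set y Y" for A
  proof
    have "s \<in> A" if "s \<in> S" "a \<in> A" "f s = f a" for s a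
      using S(2)[of s a] CY(1)[OF A] that by auto
    then have "S \<inter> f -` f ` A \<subseteq> A" by blast
    then show "Y \<inter> f -` (f ` A) \<subseteq> A"
      using dense[OF img[OF A]] closure_minimal[OF _ CY(3)[OF A]] by blast
  qed (use CY(1)[OF A] in auto)

  \<comment> \<open>One half of the estimate, that points over \<open>B'\<close> lie near
    \<open>?P\<close>, comes from \<open>infdist_preimage_small\<close> applied to \<open>B\<close>.
    For the other half \<open>?P\<close> is covered by finitely many small balls centred in
    \<open>S\<close>, and each centre has to be approximated by a point over
    \<open>B'\<close>.\<close>
  have cont_pre: "\<exists>d>0. \<forall>B'. B' \<in> C_set p X \<and> hausdorff_dist B B' < d
        \<longrightarrow> hausdorff_dist (Y \<inter> f -` B) (Y \<inter> f -` B') < e"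
    if B: "B \<in> C_set p X" and e: "0 < e" for B e
  proof -
    let ?P = "Y \<inter> f -` B"
    obtain d0 where d0: "d0 > 0" "\<And>t. t \<in> Y \<Longrightarrow> infdist (f t) B < d0 \<Longrightarrow> infdist t ?P < e/2"
      using infdist_preimage_small[OF Y f CX(3)[OF B] CX(7)[OF B], of "e/2"] e by auto
    have "?P \<subseteq> (\<Union>k\<in>S \<inter> f -` B. ball k (e/4))"
    proof
      fix t assume "t \<in> ?P"
      then have "t \<in> closure (S \<inter> f -` B)" using dense[OF B] by blast
      then show "t \<in> (\<Union>k\<in>S \<inter> f -` B. ball k (e/4))"
        using e unfolding closure_approachable by (auto dest!: spec[of _ "e/4"])
    qed
    then obtain K where K: "K \<subseteq> S \<inter> f -` B" "finite K" "?P \<subseteq> (\<Union>k\<in>K. ball k (e/4))"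
      using compactE_image[OF CY(2)[OF pre[OF B]], of "S \<inter> f -` B" "\<lambda>k. ball k (e/4)"] by auto
    \<comment> \<open>Since the fibre through \<open>k\<close> is the single point \<open>k\<close>,
      a point of \<open>Y\<close> whose image is close to \<open>f k\<close> must itself be close to
      \<open>k\<close>.\<close>
    have "\<exists>d>0. \<forall>t\<in>Y. dist (f t) (f k) < d \<longrightarrow> dist t k < e/4" if "k \<in> K" for k
    proof -
      have "Y \<inter> f -` {f k} = {k}" using that K(1) S by blast
      then show ?thesis
        using infdist_preimage_small[OF Y f, of "{f k}" "e/4"] e by (simp add: infdist_singleton)
    qed
    then obtain d where d: "\<And>k. k \<in> K \<Longrightarrow> d k > 0"
        "\<And>k t. k \<in> K \<Longrightarrow> t \<in> Y \<Longrightarrow> dist (f t) (f k) < d k \<Longrightarrow> dist t k < e/4"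
      by metis
    define D where "D = Min (insert d0 (d ` K))"
    have D: "D > 0" "D \<le> d0" "\<And>k. k \<in> K \<Longrightarrow> D \<le> d k"
      using K(2) d(1) d0(1) by (auto simp: D_def)
    have "hausdorff_dist ?P (Y \<inter> f -` B') < e"
      if B': "B' \<in> C_set p X" and less: "hausdorff_dist B B' < D" for B'
    proof -
      let ?P' = "Y \<inter> f -` B'"
      have "infdist t ?P' \<le> e/2" if t: "t \<in> ?P" for t
      proof -
        obtain k where k: "k \<in> K" "dist k t < e/4" using K(3) t by auto
        then have "f k \<in> B" using K(1) by blast
        then have "infdist (f k) B' < d k"
          using infdist_le_hausdorff_dist[OF X B B'] less D(3)[OF k(1)] by force
        then obtain b where b: "b \<in> B'" "dist (f k) b < d k"
          using infdist_less_obtain CX(7)[OF B'] by metis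
        then obtain s where s: "s \<in> Y" "f s = b" using CX(1)[OF B'] im by auto
        then have "dist s k < e/4" using d(2)[OF k(1) s(1)] b(2) by (simp add: dist_commute)
        then have "dist t s \<le> e/2" using k dist_triangle[of t s k] by (simp add: dist_commute)
        then show ?thesis using infdist_le2[of s ?P' t "e/2"] s b by auto
      qed
      moreover have "infdist t ?P \<le> e/2" if t: "t \<in> ?P'" for t
      proof -
        have "infdist (f t) B < d0"
          using infdist_le_hausdorff_dist[OF X B' B, of "f t"] less D(2) t
          by (simp add: MX.commute)
        then show ?thesis using d0(2)[of t] t by auto
      qed
      \<comment> \<open>Bounds on the one-sided distances only give a non-strict bound on the
        Hausdorff distance, so \<open>e/2\<close> is used to end strictly below
        \<open>e\<close>.\<close>
      ultimately have "hausdorff_dist ?P ?P' \<le> e/2"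
        using CY[OF pre[OF B]] CY[OF pre[OF B']] by (subst hausdorff_dist_le_iff) auto
      then show ?thesis using e by simp
    qed
    then show ?thesis using D(1) by blast
  qed
  have cont_img: "\<exists>d>0. \<forall>A'. A' \<in> C_set y Y \<and> hausdorff_dist A A' < d
        \<longrightarrow> hausdorff_dist (f ` A) (f ` A') < e"
    if A: "A \<in> C_set y Y" and e: "0 < e" for A e
  proof -
    have "uniformly_continuous_on Y f" by (rule compact_uniformly_continuous[OF f Y])
    then obtain d where d: "d > 0" "\<And>s t. s \<in> Y \<Longrightarrow> t \<in> Y \<Longrightarrow> dist s t < d \<Longrightarrow> dist (f s) (f t) < e/2"
      unfolding uniformly_continuous_on_def using e by (metis half_gt_zero)
    have half: "infdist x (f ` A2) \<le> e/2"
      if A1: "A1 \<in> C_set y Y" and A2: "A2 \<in> C_set y Y" and less: "hausdorff_dist A1 A2 < d"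
        and x: "x \<in> f ` A1" for A1 A2 x
    proof -
      obtain a where a: "a \<in> A1" "x = f a" using x by blast
      then have "infdist a A2 < d" using infdist_le_hausdorff_dist[OF Y A1 A2] less by force
      then obtain b where b: "b \<in> A2" "dist a b < d"
        using infdist_less_obtain CY(7)[OF A2] by metis
      then have "dist x (f b) \<le> e/2" using d(2)[of a b] a CY(1)[OF A1] CY(1)[OF A2] by fastforce
      then show ?thesis using infdist_le2[of "f b"] b by blast
    qed
    have "hausdorff_dist (f ` A) (f ` A') < e"
      if A': "A' \<in> C_set y Y" and less: "hausdorff_dist A A' < d" for A'
    proof -
      have "hausdorff_dist (f ` A) (f ` A') \<le> e/2"
        using CX(4,7)[OF img[OF A]] CX(4,7)[OF img[OF A']] half[OF A A' less] half[OF A' A] less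
        by (subst hausdorff_dist_le_iff) (auto simp: MY.commute)
      then show ?thesis using e by simp
    qed
    then show ?thesis using d(1) by blast
  qed
  have "homeomorphic_maps (C_space p X) (C_space y Y) (\<lambda>B. Y \<inter> f -` B) ((`) f)"
    unfolding homeomorphic_maps_def C_space_def
      MX.metric_continuous_map[OF MY.Metric_space_axioms]
      MY.metric_continuous_map[OF MX.Metric_space_axioms]
    using pre img img_pre pre_img cont_pre cont_img by auto
  then show ?thesis unfolding homeomorphic_space_def by blast
qed

text \<open>All fibres of a homeomorphism are single points, so the whole of \<open>Y\<close> can
  serve as the set \<open>S\<close> of the monotone case. This allows a continuum to be replaced by
  a homeomorphic copy.\<close>

lemma C_space_homeomorphic:
  assumes Y: "compact Y" and h: "homeomorphism Y X h k" and y: "y \<in> Y"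
  shows "C_space (h y) X homeomorphic_space C_space y Y"
proof (rule C_space_homeomorphic_monotone[where S = Y and f = h])
  have inj: "t = s" if "t \<in> Y" "s \<in> Y" "h t = h s" for s t
    using h that by (metis homeomorphism_apply1)
  then show "\<And>s t. s \<in> Y \<Longrightarrow> t \<in> Y \<Longrightarrow> h t = h s \<Longrightarrow> t = s"
    by auto
  show "continuous_on Y h" "h ` Y = X" using h by (auto simp: homeomorphism_def)
  then show "compact X" using Y compact_continuous_image by blast
  show "connected (Y \<inter> h -` {x})" if "x \<in> X" for x
  proof -
    obtain t where "t \<in> Y" "h t = x" using \<open>h ` Y = X\<close> \<open>x \<in> X\<close> by blast
    then have "Y \<inter> h -` {x} = {t}" using inj by blast
    then show ?thesis by simp
  qed
  show "Y \<inter> h -` B \<subseteq> closure (Y \<inter> h -` B)" for B by (rule closure_subset)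
qed (use Y y in auto)

subsection \<open>Embedding into the Hilbert cube\<close>

text \<open>Each point is sent to the sequence of its distances to a countable set \<open>D\<close>
  that comes arbitrarily close to every point of \<open>K\<close>. This map is continuous and
  injective, hence an embedding by compactness.\<close>

lemma compact_homeomorphic_nat_real:
  fixes K :: "'a::metric_space set"
  assumes K: "compact K"
  shows "\<exists>(Y :: (nat \<Rightarrow> real) set) h k. homeomorphism K Y h k"
proof (cases "K = {}")
  case True
  then show ?thesis by (auto simp: homeomorphism_def)
next
  case False
  have "\<exists>F. finite F \<and> K \<subseteq> (\<Union>x\<in>F. ball x (inverse (real (Suc n))))" for n
    using K compact_eq_totally_bounded[of K] by simp
  then obtain F where F: "\<And>n. finite (F n)"
      "\<And>n. K \<subseteq> (\<Union>x\<in>F n. ball x (inverse (real (Suc n))))"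
    by metis
  define D where "D = (\<Union>n. F n)"
  have "countable D" using F(1) by (auto simp: D_def countable_finite)
  moreover have "D \<noteq> {}" using F(2)[of 0] False by (auto simp: D_def)
  ultimately have d: "range (from_nat_into D) = D" by (simp add: range_from_nat_into)
  define h where "h = (\<lambda>x (n::nat). dist x (from_nat_into D n))"
  have "continuous_on K h"
    by (rule continuous_on_coordinatewise_then_product) (auto simp: h_def intro: continuous_intros)
  moreover have "inj_on h K"
  proof (rule inj_onI, rule ccontr)
    fix x y assume xy: "x \<in> K" "y \<in> K" "h x = h y" "x \<noteq> y"
    then obtain n where n: "inverse (real (Suc n)) < dist x y / 2"
      using reals_Archimedean[of "dist x y / 2"] by auto
    \<comment> \<open>Equal distance sequences put \<open>z\<close> as close to \<open>y\<close> as
      to \<open>x\<close>, that is, closer than half of \<open>dist x y\<close> to both.\<close>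
    obtain z where z: "z \<in> F n" "dist z x < inverse (real (Suc n))" using F(2)[of n] xy(1) by auto
    then obtain m where "z = from_nat_into D m" using d unfolding D_def by blast
    then have "dist x z = dist y z" using fun_cong[OF xy(3), of m] by (simp add: h_def)
    then show False using z n dist_triangle2[of x y z] by (simp add: dist_commute)
  qed
  ultimately show ?thesis using homeomorphism_compact[OF K _ refl] by blast
qed

subsection \<open>Finite unions of arcs\<close>

lemma arc_locally_connected: "is_arc A \<Longrightarrow> locally connected A"
  unfolding is_arc_def
  using homeomorphic_locally[of A "{0..1::real}" connected connected] homeomorphic_connectedness
    convex_imp_locally_connected[of "{0..1::real}"] by auto

text \<open>Among finitely many arcs, one arc \<open>A\<close> already has \<open>z\<close> in the
  closure of \<open>D \<inter> A\<close>. A small connected neighbourhood of \<open>z\<close> within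
  \<open>A\<close> then meets \<open>D\<close>.\<close>

lemma finite_arcs_connected_approach:
  assumes fin: "finite \<A>" and arcs: "\<And>A. A \<in> \<A> \<Longrightarrow> is_arc A"
    and D: "D \<subseteq> \<Union>\<A>" "z \<in> closure D" and U: "open U" "z \<in> U"
  obtains V d where "connected V" "V \<subseteq> \<Union>\<A> \<inter> U" "z \<in> V" "d \<in> V" "d \<in> D"
proof -
  have "closed (\<Union>A\<in>\<A>. closure (D \<inter> A))" using fin by blast
  moreover have "D \<subseteq> (\<Union>A\<in>\<A>. closure (D \<inter> A))"
  proof
    fix x assume "x \<in> D"
    then obtain A where "A \<in> \<A>" "x \<in> D \<inter> A" using D(1) by blast
    then show "x \<in> (\<Union>A\<in>\<A>. closure (D \<inter> A))" using closure_subset[of "D \<inter> A"] by blast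
  qed
  ultimately have "z \<in> (\<Union>A\<in>\<A>. closure (D \<inter> A))" using D(2) closure_minimal by blast
  then obtain A where A: "A \<in> \<A>" "z \<in> closure (D \<inter> A)" by blast
  have "closed A"
    using arcs[OF A(1)] homeomorphic_compactness[of A "{0..1::real}"] compact_imp_closed
    by (auto simp: is_arc_def)
  then have "z \<in> A" using A(2) closure_minimal[of "D \<inter> A" A] by blast
  moreover have "openin (top_of_set A) (A \<inter> U)" using U by (auto simp: openin_open)
  ultimately obtain V where V: "openin (top_of_set A) V" "connected V" "z \<in> V" "V \<subseteq> A \<inter> U"
    using arc_locally_connected[OF arcs[OF A(1)]] U unfolding locally_connected by (metis IntI)
  then obtain W where W: "open W" "V = A \<inter> W" by (auto simp: openin_open)
  then have "W \<inter> (D \<inter> A) \<noteq> {}" using open_Int_closure_eq_empty A(2) V(3) by blast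
  then obtain d where "d \<in> D" "d \<in> V" using W by blast
  then show ?thesis using that V A by blast
qed

lemma finite_arcs_homeomorphic:
  assumes h: "homeomorphism S T h k" and S: "S = \<Union>\<A>" "finite \<A>" "\<And>A. A \<in> \<A> \<Longrightarrow> is_arc A"
  shows "\<exists>\<B>. finite \<B> \<and> (\<forall>B\<in>\<B>. is_arc B) \<and> T = \<Union>\<B>"
proof (intro exI conjI ballI)
  show "finite ((`) h ` \<A>)" using S by blast
  show "T = \<Union> ((`) h ` \<A>)" using h S(1) by (auto simp: homeomorphism_def)
  fix B assume "B \<in> (`) h ` \<A>"
  then obtain A where A: "A \<in> \<A>" "B = h ` A" by blast
  then have "homeomorphism A B h k"
    using homeomorphism_of_subsets[OF h] S(1) by blast
  then have "A homeomorphic B" by (auto simp: homeomorphic_def)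
  then show "is_arc B" using S(3)[OF A(1)] homeomorphic_sym homeomorphic_trans
    unfolding is_arc_def by blast
qed

text \<open>A nonempty union of arcs contains an arc, which is infinite and so does not fit into
  \<open>{p}\<close>.\<close>

lemma finite_graph_other_point:
  assumes "finite_graph X"
  obtains q where "q \<in> X" "q \<noteq> p"
proof -
  obtain \<A> where "\<forall>A\<in>\<A>. is_arc A" "X = \<Union>\<A>" "X \<noteq> {}"
    using assms by (auto simp: finite_graph_def continuum_def)
  then obtain A where A: "A \<subseteq> X" "is_arc A" by blast
  then obtain h k where "homeomorphism A {0..1::real} h k"
    by (auto simp: is_arc_def homeomorphic_def)
  then have "h ` A = {0..1}" by (simp add: homeomorphism_def)
  then have "infinite A" by (metis finite_imageI infinite_Icc zero_less_one)
  then have "\<not> A \<subseteq> {p}" using finite_subset by blast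
  then show ?thesis using that A by blast
qed

subsection \<open>The oscillating continuum\<close>

text \<open>At \<open>x = q\<close> the last equation reads \<open>0 = 0\<close>, so the fibre over \<open>q\<close> is all of \<open>[-1, 1]\<close>;
  elsewhere it says \<open>t = sin (1 / dist x q)\<close>.\<close>

definition sine_cone :: "'a::metric_space set \<Rightarrow> 'a \<Rightarrow> ('a \<times> real) set" where
  "sine_cone X q = {(x, t). x \<in> X \<and> t \<in> {-1..1} \<and> dist x q * t = dist x q * sin (1 / dist x q)}"

lemma sine_cone_iff:
  "(x, t) \<in> sine_cone X q \<longleftrightarrow>
     x \<in> X \<and> (if x = q then t \<in> {-1..1} else t = sin (1 / dist x q))"
  by (auto simp: sine_cone_def)

lemma continuous_on_mult_sin_inverse: "continuous_on UNIV (\<lambda>r::real. r * sin (1 / r))"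
proof -
  have "isCont (\<lambda>r::real. r * sin (1 / r)) r" for r
  proof (cases "r = 0")
    \<comment> \<open>The factor \<open>r\<close> makes the value at \<open>0\<close> equal to
      \<open>0\<close>, whatever \<open>1 / 0\<close> is, and the bound by \<bar>r\<bar> gives the
      same limit.\<close>
    case True
    have "((\<lambda>r::real. r * sin (1 / r)) \<longlongrightarrow> 0) (at 0)"
    proof (rule Lim_null_comparison)
      show "\<forall>\<^sub>F r in at (0::real). norm (r * sin (1 / r)) \<le> \<bar>r\<bar>"
        by (auto simp: abs_mult intro!: always_eventually mult_left_le)
      show "((\<lambda>r::real. \<bar>r\<bar>) \<longlongrightarrow> 0) (at 0)"
        by (rule tendsto_rabs_zero[OF tendsto_ident_at])
    qed
    then show ?thesis using True by (simp add: isCont_def)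
  qed (auto intro!: continuous_intros)
  then show ?thesis by (simp add: continuous_on_eq_continuous_at)
qed

text \<open>Multiplying the equation of the graph by \<open>dist x q\<close> makes both sides
  continuous even at \<open>q\<close>, so it cuts out a closed subset of the compact product of
  \<open>X\<close> and \<open>[-1, 1]\<close>.\<close>

lemma compact_sine_cone:
  assumes "compact X"
  shows "compact (sine_cone X q)"
proof -
  let ?E = "{z :: 'a \<times> real. dist (fst z) q * snd z = dist (fst z) q * sin (1 / dist (fst z) q)}"
  have "continuous_on UNIV (\<lambda>z::'a \<times> real. dist (fst z) q * sin (1 / dist (fst z) q))"
    by (rule continuous_on_compose2[OF continuous_on_mult_sin_inverse]) (auto intro!: continuous_intros)
  moreover have "continuous_on UNIV (\<lambda>z::'a \<times> real. dist (fst z) q * snd z)"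
    by (intro continuous_intros)
  ultimately have "closed ?E" by (intro closed_Collect_eq)
  moreover have "sine_cone X q = (X \<times> {-1..1}) \<inter> ?E" by (auto simp: sine_cone_def)
  ultimately show ?thesis using assms by (simp add: compact_Int_closed compact_Times)
qed

lemma connected_sine_cone_fibre:
  assumes "x \<in> X"
  shows "connected (sine_cone X q \<inter> fst -` {x})"
proof -
  have "sine_cone X q \<inter> fst -` {x} = {x} \<times> (if x = q then {-1..1} else {sin (1 / dist x q)})"
    using assms by (auto simp: sine_cone_iff split: if_splits)
  then show ?thesis by (auto simp: connected_Times)
qed

lemma sin_inverse_takes_value:
  fixes t e :: real
  assumes t: "t \<in> {-1..1}" and e: "0 < e"
  obtains r where "0 < r" "r < e" "sin (1 / r) = t"
proof -
  \<comment> \<open>The summand \<open>2\<close> absorbs \<open>arcsin t\<close>, which is at least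
    \<open>- 2\<close>; adding \<open>2 * pi * n\<close>, which is at least \<open>n\<close>, then
    exceeds \<open>1 / e\<close>.\<close>
  obtain n :: nat where n: "1 / e + 2 < real n" using reals_Archimedean2 by blast
  define R where "R = arcsin t + 2 * pi * real n"
  have "- (pi / 2) \<le> arcsin t" using arcsin_lbound t by auto
  then have "- 2 \<le> arcsin t" using pi_less_4 by linarith
  moreover have "real n \<le> 2 * pi * real n"
    using mult_right_mono[of 1 "2 * pi" "real n"] pi_ge_two by simp
  ultimately have R: "1 / e < R" using n unfolding R_def by linarith
  then have "0 < R" using e by (meson less_trans zero_less_divide_1_iff)
  moreover have "sin R = t" unfolding R_def
    using sin.plus_of_nat[of "arcsin t" n] t by (auto simp: sin_add mult.commute mult.left_commute)
  ultimately show ?thesis using that[of "1 / R"] R e by (simp add: field_simps)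
qed

text \<open>By connectedness the distance to \<open>q\<close> takes on \<open>B\<close> every value
  between \<open>0\<close> and \<open>dist p q\<close>, in particular a small \<open>r\<close> with
  \<open>sin (1 / r) = t\<close>.\<close>

lemma connected_sin_dist_value:
  assumes B: "connected B" "p \<in> B" "q \<in> B" "p \<noteq> q" and t: "t \<in> {-1..1}" and e: "0 < e"
  obtains x where "x \<in> B" "x \<noteq> q" "dist x q < e" "sin (1 / dist x q) = t"
proof -
  obtain r where r: "0 < r" "r < min e (dist p q)" "sin (1 / r) = t"
    using sin_inverse_takes_value[OF t, of "min e (dist p q)"] e B(4) by auto
  have "connected ((\<lambda>x. dist x q) ` B)"
    by (intro connected_continuous_image continuous_intros B(1))
  moreover have "0 \<in> (\<lambda>x. dist x q) ` B" "dist p q \<in> (\<lambda>x. dist x q) ` B"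
    using B by (auto intro!: image_eqI[of 0])
  ultimately have "{0..dist p q} \<subseteq> (\<lambda>x. dist x q) ` B" by (rule connected_contains_Icc)
  moreover have "r \<in> {0..dist p q}" using r by simp
  ultimately obtain x where "x \<in> B" "dist x q = r" by blast
  then show ?thesis using that r by auto
qed

lemma sine_cone_preimage_dense:
  assumes B: "connected B" "p \<in> B" "B \<subseteq> X" "p \<noteq> q"
  shows "sine_cone X q \<inter> fst -` B \<subseteq> closure ((sine_cone X q - fst -` {q}) \<inter> fst -` B)"
    (is "_ \<subseteq> closure ?S")
proof
  fix z assume z: "z \<in> sine_cone X q \<inter> fst -` B"
  obtain x t where xt: "z = (x, t)" by (cases z)
  show "z \<in> closure ?S"
  proof (cases "x = q")
    case False
    then have "z \<in> ?S" using z xt by auto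
    then show ?thesis by (rule subsetD[OF closure_subset])
  next
    case True
    then have q: "q \<in> B" and t: "t \<in> {-1..1}" using z xt by (auto simp: sine_cone_iff)
    show ?thesis unfolding closure_approachable
    proof (intro allI impI)
      fix e :: real assume "0 < e"
      then obtain w where w: "w \<in> B" "w \<noteq> q" "dist w q < e" "sin (1 / dist w q) = t"
        using connected_sin_dist_value[OF B(1,2) q B(4) t] by blast
      \<comment> \<open>The approximating point has the same height \<open>t\<close> as
        \<open>z\<close>, so its distance from \<open>z\<close> is just
        \<open>dist w q\<close>.\<close>
      then have "(w, t) \<in> ?S" using B(3) by (auto simp: sine_cone_iff)
      moreover have "dist (w, t) z < e" using w xt True by (simp add: dist_Pair_Pair)
      ultimately show "\<exists>y\<in>?S. dist y z < e" by blast
    qed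
  qed
qed

text \<open>If there were such arcs, a connected set in the upper half would join the top
  \<open>(q, 1)\<close> of the bar to a point off the bar. Its projection is connected, so it
  contains some \<open>x\<close> other than \<open>q\<close> with
  \<open>sin (1 / dist x q) = -1\<close>; the only point over \<open>x\<close> has height
  \<open>-1\<close>, which is not in the upper half.\<close>

lemma sine_cone_not_finite_arcs:
  assumes X: "connected X" "p \<in> X" "q \<in> X" "p \<noteq> q"
    and arcs: "finite \<A>" "\<And>A. A \<in> \<A> \<Longrightarrow> is_arc A" "sine_cone X q = \<Union>\<A>"
  shows False
proof -
  let ?U = "{z::'a \<times> real. 0 < snd z}"
  define D where "D = sine_cone X q - fst -` {q}"
  have "(q, 1) \<in> sine_cone X q \<inter> fst -` X" using X(3) by (auto simp: sine_cone_iff)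
  then have "(q, 1) \<in> closure D"
    using sine_cone_preimage_dense[OF X(1,2) subset_refl X(4)]
      closure_mono[of "D \<inter> fst -` X" D] unfolding D_def by blast
  moreover have "open ?U" by (intro open_Collect_less continuous_intros)
  moreover have "D \<subseteq> \<Union>\<A>" using arcs(3) by (auto simp: D_def)
  ultimately obtain V d where V: "connected V" "V \<subseteq> \<Union>\<A> \<inter> ?U" "(q, 1) \<in> V" "d \<in> V" "d \<in> D"
    using finite_arcs_connected_approach[of \<A> D "(q, 1)" ?U] arcs(1,2)
    by (metis (mono_tags, lifting) mem_Collect_eq snd_conv zero_less_one)
  have fV: "connected (fst ` V)" by (intro connected_continuous_image continuous_intros V(1))
  have d: "fst d \<in> fst ` V" "q \<in> fst ` V" "fst d \<noteq> q"
    using V(3,4,5) by (force simp: D_def)+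
  obtain x where x: "x \<in> fst ` V" "x \<noteq> q" "sin (1 / dist x q) = -1"
    by (rule connected_sin_dist_value[OF fV d, of "-1" 1]) auto
  then obtain s where "(x, s) \<in> V" by auto
  then have "(x, s) \<in> sine_cone X q" "0 < s" using V(2) arcs(3) by auto
  then show False using x by (auto simp: sine_cone_iff)
qed

section \<open>Passing from the sine cone to its copy in the Hilbert cube\<close>

theorem theorem4p1:
  fixes X :: "'a::metric_space set" and p :: 'a
  assumes "finite_graph X" and "p \<in> X"
  shows "\<exists>(Y :: (nat \<Rightarrow> real) set) y. continuum Y \<and> \<not> finite_graph Y \<and> y \<in> Y \<and>
           C_space p X homeomorphic_space C_space y Y"
proof -
  obtain q where q: "q \<in> X" "q \<noteq> p" using finite_graph_other_point[OF assms(1)] .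
  have X: "compact X" "connected X" using assms(1) by (auto simp: finite_graph_def continuum_def)
  let ?Z = "sine_cone X q"
  define z where "z = (p, sin (1 / dist p q))"
  have z: "z \<in> ?Z" using assms(2) q by (auto simp: z_def sine_cone_iff)
  have Z: "compact ?Z" by (rule compact_sine_cone[OF X(1)])
  have fst_im: "fst ` ?Z = X"
  proof
    show "X \<subseteq> fst ` ?Z"
    proof
      fix x assume "x \<in> X"
      then have "(x, sin (1 / dist x q)) \<in> ?Z" by (auto simp: sine_cone_iff)
      then show "x \<in> fst ` ?Z" by force
    qed
  qed (auto simp: sine_cone_iff)
  have cont: "continuous_on ?Z fst" by (intro continuous_intros)
  \<comment> \<open>The whole cone is the preimage of the connected set \<open>X\<close> under a
    projection with connected fibres.\<close>
  have "connected (?Z \<inter> fst -` X)"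
    using connected_preimage_compact[OF Z cont fst_im connected_sine_cone_fibre X(2)] by blast
  moreover have "?Z \<inter> fst -` X = ?Z" using fst_im by blast
  ultimately have conn: "connected ?Z" by simp
  have XZ: "C_space p X homeomorphic_space C_space z ?Z"
  proof (rule C_space_homeomorphic_monotone[OF X(1) Z cont fst_im z])
    show "fst z = p" by (simp add: z_def)
    show "?Z - fst -` {q} \<subseteq> ?Z" by blast
    show "t = s" if "s \<in> ?Z - fst -` {q}" "t \<in> ?Z" "fst t = fst s" for s t
      using that by (cases s; cases t) (auto simp: sine_cone_iff)
    show "?Z \<inter> fst -` B \<subseteq> closure ((?Z - fst -` {q}) \<inter> fst -` B)" if "B \<in> C_set p X" for B
      using sine_cone_preimage_dense C_set_compact[OF X(1) that] q by metis
  qed (rule connected_sine_cone_fibre)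
  obtain Y :: "(nat \<Rightarrow> real) set" and h k where hk: "homeomorphism ?Z Y h k"
    using compact_homeomorphic_nat_real[OF Z] by blast
  then have him: "h ` ?Z = Y" "continuous_on ?Z h" by (auto simp: homeomorphism_def)
  show ?thesis
  proof (intro exI conjI)
    show "h z \<in> Y" using him z by blast
    then show "continuum Y" unfolding continuum_def
      using him compact_continuous_image[OF _ Z] connected_continuous_image[OF _ conn] by blast
    show "\<not> finite_graph Y"
    proof
      assume "finite_graph Y"
      then obtain \<A> where "finite \<A>" "\<forall>A\<in>\<A>. is_arc A" "Y = \<Union>\<A>"
        by (auto simp: finite_graph_def)
      \<comment> \<open>A decomposition of \<open>Y\<close> into arcs is carried back to the cone by
        the inverse homeomorphism.\<close>
      then obtain \<B> where B: "finite \<B>" "\<forall>B\<in>\<B>. is_arc B" "?Z = \<Union>\<B>"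
        using finite_arcs_homeomorphic[OF homeomorphism_symD[OF hk], of \<A>] by auto
      show False
        using sine_cone_not_finite_arcs[OF X(2) assms(2) q(1) q(2)[symmetric] B(1) _ B(3)] B(2)
        by simp
    qed
    show "C_space p X homeomorphic_space C_space (h z) Y"
      using XZ C_space_homeomorphic[OF Z hk z] homeomorphic_space_sym homeomorphic_space_trans
      by metis
  qed
qed

end
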